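(* Let $L$ be a Lie algebra over a field $\mathbb{k}$ and $X=\mathbb{k}\oplus L$ with the coalgebra structure $(\Delta,\epsilon)$ and the operations $T,\tilde T:X^{\otimes 3}\to X$ given in the context. Then $T$ satisfies the reversibility condition with respect to $\tilde T$; that is, for all $x,y,z\in X$, $$\tilde T\big(T(x\otimes y^{(2)}\otimes z^{(2)})\otimes z^{(1)}\otimes y^{(1)}\big)=\epsilon(y)\epsilon(z)\,x,$$ and the same equation holds with the roles of $T$ and $\tilde T$ exchanged: $$T\big(\tilde T(x\otimes y^{(2)}\otimes z^{(2)})\otimes z^{(1)}\otimes y^{(1)}\big)=\epsilon(y)\epsilon(z)\,x.$$
   Context: Tensor products are over $\mathbb{k}$. Elements of $X=\mathbb{k}\oplus L$ are written as pairs $(a,x)$, $a\in\mathbb{k}$, $x\in L$. The linear maps are $$\Delta(a,x)=(a,x)\otimes(1,0)+(1,0)\otimes(0,x),\qquad \epsilon(a,x)=a,$$ $$T((a,x)\otimes(b,y)\otimes(c,z))=(abc,\ bcx+c[x,y]+b[x,z]+[[x,y],z]),$$ $$\tilde T((a,x)\otimes(b,y)\otimes(c,z))=(abc,\ bcx-c[x,y]-b[x,z]+[[x,y],z]).$$ Sweedler notation $\Delta(y)=y^{(1)}\otimes y^{(2)}$ (sum understood) is used. *)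

theory Defs
  imports
    "HOL-Library.Poly_Mapping"
    "HOL-Library.Set_Algebras"
    "HOL-Analysis.Product_Vector"
begin

section \<open>Tensor powers of a vector space\<close>

text \<open>
  The tensor power \<open>V\<^sup>\<otimes>\<^sup>n\<close> is the free vector space on \<open>V\<^sup>n\<close> (finitely supported functions on
  lists of length \<open>n\<close>) modulo the multilinearity relations. Since the quotient depends on the
  scalar multiplication \<open>s\<close> of \<open>V\<close>, which is a parameter and not determined by the type, tensors
  are represented as cosets of the relation subspace; the sum of two tensors is the elementwise sum
  of cosets from \<^theory>\<open>HOL-Library.Set_Algebras\<close>.
\<close>

definition free_scale :: "'k::field \<Rightarrow> ('i \<Rightarrow>\<^sub>0 'k) \<Rightarrow> ('i \<Rightarrow>\<^sub>0 'k)" where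
  "free_scale c p = Poly_Mapping.map ((*) c) p"

definition tensor_rels ::
  "('k::field \<Rightarrow> 'v::ab_group_add \<Rightarrow> 'v) \<Rightarrow> nat \<Rightarrow> ('v list \<Rightarrow>\<^sub>0 'k) set" where
  "tensor_rels s n =
     {Poly_Mapping.single (xs[i := v + w]) 1
        - Poly_Mapping.single (xs[i := v]) 1 - Poly_Mapping.single (xs[i := w]) 1
      | xs i v w. length xs = n \<and> i < n}
   \<union> {Poly_Mapping.single (xs[i := s c v]) 1
        - free_scale c (Poly_Mapping.single (xs[i := v]) 1)
      | xs i c v. length xs = n \<and> i < n}"

definition tensor_class ::
  "('k::field \<Rightarrow> 'v::ab_group_add \<Rightarrow> 'v) \<Rightarrow> nat \<Rightarrow> ('v list \<Rightarrow>\<^sub>0 'k) \<Rightarrow> ('v list \<Rightarrow>\<^sub>0 'k) set" where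
  "tensor_class s n p = {q. q - p \<in> module.span free_scale (tensor_rels s n)}"

definition tensor_power ::
  "('k::field \<Rightarrow> 'v::ab_group_add \<Rightarrow> 'v) \<Rightarrow> nat \<Rightarrow> ('v list \<Rightarrow>\<^sub>0 'k) set set" where
  "tensor_power s n =
     tensor_class s n ` {p. \<forall>xs \<in> Poly_Mapping.keys p. length xs = n}"

definition tensor_scale ::
  "('k::field \<Rightarrow> 'v::ab_group_add \<Rightarrow> 'v) \<Rightarrow> nat \<Rightarrow> 'k
     \<Rightarrow> ('v list \<Rightarrow>\<^sub>0 'k) set \<Rightarrow> ('v list \<Rightarrow>\<^sub>0 'k) set" where
  "tensor_scale s n c U =
     {free_scale c p + r | p r. p \<in> U \<and> r \<in> module.span free_scale (tensor_rels s n)}"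

text \<open>\<open>tensor s [x\<^sub>1, \<dots>, x\<^sub>n]\<close> is the pure tensor \<open>x\<^sub>1 \<otimes> \<dots> \<otimes> x\<^sub>n\<close>.\<close>

definition tensor ::
  "('k::field \<Rightarrow> 'v::ab_group_add \<Rightarrow> 'v) \<Rightarrow> 'v list \<Rightarrow> ('v list \<Rightarrow>\<^sub>0 'k) set" where
  "tensor s xs = tensor_class s (length xs) (Poly_Mapping.single xs 1)"

definition multilinear ::
  "('k::field \<Rightarrow> 'v::ab_group_add \<Rightarrow> 'v) \<Rightarrow> ('k \<Rightarrow> 'w::ab_group_add \<Rightarrow> 'w) \<Rightarrow> nat
     \<Rightarrow> ('v list \<Rightarrow> 'w) \<Rightarrow> bool" where
  "multilinear s t n f \<longleftrightarrow>
     (\<forall>xs i. length xs = n \<longrightarrow> i < n \<longrightarrow>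
        (\<forall>v w. f (xs[i := v + w]) = f (xs[i := v]) + f (xs[i := w])) \<and>
        (\<forall>c v. f (xs[i := s c v]) = t c (f (xs[i := v]))))"

definition free_lift ::
  "('k::field \<Rightarrow> 'w::ab_group_add \<Rightarrow> 'w) \<Rightarrow> ('v list \<Rightarrow> 'w) \<Rightarrow> ('v list \<Rightarrow>\<^sub>0 'k) \<Rightarrow> 'w" where
  "free_lift t f p = (\<Sum>xs \<in> Poly_Mapping.keys p. t (Poly_Mapping.lookup p xs) (f xs))"

text \<open>
  For \<open>n\<close>-multilinear \<open>f\<close>, \<open>tensor_lift t f\<close> is the linear map on \<open>V\<^sup>\<otimes>\<^sup>n\<close> with
  \<open>x\<^sub>1 \<otimes> \<dots> \<otimes> x\<^sub>n \<mapsto> f [x\<^sub>1, \<dots>, x\<^sub>n]\<close>; the choice of representative is then immaterial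
  (lemmas \<open>tensor_lift_class\<close>, \<open>tensor_lift_add\<close>, \<open>tensor_lift_scale\<close>, \<open>tensor_lift_tensor\<close>).
\<close>

definition tensor_lift ::
  "('k::field \<Rightarrow> 'w::ab_group_add \<Rightarrow> 'w) \<Rightarrow> ('v list \<Rightarrow> 'w) \<Rightarrow> ('v list \<Rightarrow>\<^sub>0 'k) set \<Rightarrow> 'w" where
  "tensor_lift t f U = free_lift t f (SOME p. p \<in> U)"

lemma lookup_free_scale [simp]:
  "Poly_Mapping.lookup (free_scale c p) i = c * Poly_Mapping.lookup p i"
  by (simp add: free_scale_def Poly_Mapping.map.rep_eq when_def)

lemma vector_space_free_scale: "vector_space (free_scale :: 'k::field \<Rightarrow> ('i \<Rightarrow>\<^sub>0 'k) \<Rightarrow> _)"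
  by unfold_locales (rule poly_mapping_eqI; simp add: lookup_add algebra_simps)+

interpretation free: vector_space "free_scale :: 'k::field \<Rightarrow> ('i \<Rightarrow>\<^sub>0 'k) \<Rightarrow> _"
  by (rule vector_space_free_scale)

lemma free_lift_superset:
  assumes "vector_space t" "finite A" "Poly_Mapping.keys p \<subseteq> A"
  shows "free_lift t f p = (\<Sum>xs\<in>A. t (Poly_Mapping.lookup p xs) (f xs))"
proof -
  interpret vector_space t by fact
  show ?thesis unfolding free_lift_def
    by (rule sum.mono_neutral_left) (use assms in \<open>auto simp: in_keys_iff\<close>)
qed

lemma linear_free_lift:
  assumes "vector_space t"
  shows "Vector_Spaces.linear free_scale t (free_lift t f)"
proof -
  interpret vector_space t by fact
  have add: "free_lift t f (p + q) = free_lift t f p + free_lift t f q" for p q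
  proof -
    let ?A = "Poly_Mapping.keys p \<union> Poly_Mapping.keys q"
    have "Poly_Mapping.keys (p + q) \<subseteq> ?A" by (rule Poly_Mapping.keys_add)
    then show ?thesis
      by (simp add: free_lift_superset[OF assms, of ?A] lookup_add scale_left_distrib sum.distrib)
  qed
  have scl: "free_lift t f (free_scale c p) = t c (free_lift t f p)" for c p
  proof -
    have "Poly_Mapping.keys (free_scale c p) \<subseteq> Poly_Mapping.keys p"
      by (auto simp: in_keys_iff)
    then show ?thesis
      by (simp add: free_lift_superset[OF assms, of "Poly_Mapping.keys p"] scale_sum_right)
  qed
  show ?thesis
    by unfold_locales (auto simp: add scl)
qed

lemma free_lift_single [simp]:
  assumes "vector_space t"
  shows "free_lift t f (Poly_Mapping.single xs 1) = f xs"
proof -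
  interpret vector_space t by fact
  show ?thesis by (simp add: free_lift_def)
qed

lemma free_lift_rels:
  assumes t: "vector_space t" and f: "multilinear s t n f"
    and p: "p \<in> free.span (tensor_rels s n)"
  shows "free_lift t f p = 0"
proof -
  interpret L: Vector_Spaces.linear free_scale t "free_lift t f" by (rule linear_free_lift[OF t])
  show ?thesis
    by (rule L.eq_0_on_span[OF _ p])
       (use f in \<open>auto simp: tensor_rels_def multilinear_def L.diff L.scale t\<close>)
qed

lemma tensor_class_self: "p \<in> tensor_class s n p"
  by (simp add: tensor_class_def free.span_zero)

lemma tensor_lift_class:
  assumes t: "vector_space t" and f: "multilinear s t n f"
  shows "tensor_lift t f (tensor_class s n p) = free_lift t f p"
proof -
  interpret L: Vector_Spaces.linear free_scale t "free_lift t f" by (rule linear_free_lift[OF t])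
  have "(SOME q. q \<in> tensor_class s n p) \<in> tensor_class s n p"
    by (rule someI) (rule tensor_class_self)
  then have "free_lift t f ((SOME q. q \<in> tensor_class s n p) - p) = 0"
    by (intro free_lift_rels[OF t f]) (simp add: tensor_class_def)
  then show ?thesis by (simp add: tensor_lift_def L.diff)
qed

lemma tensor_lift_tensor:
  assumes "vector_space t" "multilinear s t (length xs) f"
  shows "tensor_lift t f (tensor s xs) = f xs"
  by (simp add: tensor_def tensor_lift_class[OF assms] assms(1))

lemma tensor_class_add:
  "tensor_class s n p + tensor_class s n q = tensor_class s n (p + q)"
proof
  show "tensor_class s n p + tensor_class s n q \<subseteq> tensor_class s n (p + q)"
    by (auto simp: tensor_class_def set_plus_def add_diff_add intro: free.span_add)
  show "tensor_class s n (p + q) \<subseteq> tensor_class s n p + tensor_class s n q"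
  proof
    fix r assume "r \<in> tensor_class s n (p + q)"
    then have "r - q \<in> tensor_class s n p" by (simp add: tensor_class_def algebra_simps)
    then have "(r - q) + q \<in> tensor_class s n p + tensor_class s n q"
      by (intro set_plus_intro tensor_class_self)
    then show "r \<in> tensor_class s n p + tensor_class s n q" by simp
  qed
qed

lemma tensor_class_scale:
  "tensor_scale s n c (tensor_class s n p) = tensor_class s n (free_scale c p)"
proof
  show "tensor_scale s n c (tensor_class s n p) \<subseteq> tensor_class s n (free_scale c p)"
  proof
    fix x assume "x \<in> tensor_scale s n c (tensor_class s n p)"
    then obtain q r where x: "x = free_scale c q + r"
      and q: "q - p \<in> free.span (tensor_rels s n)" and r: "r \<in> free.span (tensor_rels s n)"
      by (auto simp: tensor_scale_def tensor_class_def)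
    have "x - free_scale c p = free_scale c (q - p) + r"
      by (simp add: x free.scale_right_diff_distrib)
    then show "x \<in> tensor_class s n (free_scale c p)"
      using q r by (simp add: tensor_class_def free.span_add free.span_scale)
  qed
  show "tensor_class s n (free_scale c p) \<subseteq> tensor_scale s n c (tensor_class s n p)"
  proof
    fix x assume "x \<in> tensor_class s n (free_scale c p)"
    then have "x - free_scale c p \<in> free.span (tensor_rels s n)" by (simp add: tensor_class_def)
    moreover have "x = free_scale c p + (x - free_scale c p)" by simp
    ultimately show "x \<in> tensor_scale s n c (tensor_class s n p)"
      using tensor_class_self unfolding tensor_scale_def by blast
  qed
qed

lemma tensor_lift_add:
  assumes t: "vector_space t" and f: "multilinear s t n f"
    and "U \<in> tensor_power s n" "V \<in> tensor_power s n"
  shows "tensor_lift t f (U + V) = tensor_lift t f U + tensor_lift t f V"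
proof -
  interpret L: Vector_Spaces.linear free_scale t "free_lift t f" by (rule linear_free_lift[OF t])
  show ?thesis
    using assms(3,4)
    by (auto simp: tensor_power_def tensor_class_add tensor_lift_class[OF t f] L.add)
qed

lemma tensor_lift_scale:
  assumes t: "vector_space t" and f: "multilinear s t n f" and "U \<in> tensor_power s n"
  shows "tensor_lift t f (tensor_scale s n c U) = t c (tensor_lift t f U)"
proof -
  interpret L: Vector_Spaces.linear free_scale t "free_lift t f" by (rule linear_free_lift[OF t])
  show ?thesis
    using assms(3)
    by (auto simp: tensor_power_def tensor_class_scale tensor_lift_class[OF t f] L.scale)
qed

lemma tensor_in_tensor_power: "tensor s xs \<in> tensor_power s (length xs)"
  by (auto simp: tensor_def tensor_power_def)

lemma tensor_power_add:
  "U \<in> tensor_power s n \<Longrightarrow> V \<in> tensor_power s n \<Longrightarrow> U + V \<in> tensor_power s n"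
  using Poly_Mapping.keys_add by (fastforce simp: tensor_power_def tensor_class_add)


lemma tensor_class_eqI:
  assumes "p - q \<in> free.span (tensor_rels s n)"
  shows "tensor_class s n p = tensor_class s n q"
proof -
  have "r - q \<in> free.span (tensor_rels s n)" if "r - p \<in> free.span (tensor_rels s n)" for r
    using free.span_add[OF that assms] by simp
  moreover have "r - p \<in> free.span (tensor_rels s n)" if "r - q \<in> free.span (tensor_rels s n)" for r
    using free.span_diff[OF that assms] by simp
  ultimately show ?thesis by (auto simp: tensor_class_def)
qed

lemma tensor_add:
  assumes "i < length xs"
  shows "tensor s (xs[i := v + w]) = tensor s (xs[i := v]) + tensor s (xs[i := w])"
  unfolding tensor_def length_list_update tensor_class_add
  by (rule tensor_class_eqI, rule free.span_base)
     (use assms in \<open>auto simp: tensor_rels_def diff_diff_eq[symmetric]\<close>)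

lemma tensor_smult:
  assumes "i < length xs"
  shows "tensor s (xs[i := s c v]) = tensor_scale s (length xs) c (tensor s (xs[i := v]))"
  unfolding tensor_def length_list_update tensor_class_scale
  by (rule tensor_class_eqI, rule free.span_base) (use assms in \<open>unfold tensor_rels_def, blast\<close>)

lemma tensor_scale_add:
  assumes "U \<in> tensor_power s n" "V \<in> tensor_power s n"
  shows "tensor_scale s n c (U + V) = tensor_scale s n c U + tensor_scale s n c V"
  using assms
  by (auto simp: tensor_power_def tensor_class_add tensor_class_scale free.scale_right_distrib)


section \<open>Sweedler notation and the reversibility condition\<close>

text \<open>
  For a linear \<open>\<Delta> : V \<rightarrow> V \<otimes> V\<close> and bilinear \<open>\<beta>\<close>, \<open>sweedler t \<Delta> \<beta> y\<close> is
  \<open>\<beta>(y\<^sup>(\<^sup>1\<^sup>), y\<^sup>(\<^sup>2\<^sup>))\<close>, i.e. the linear map \<open>V \<otimes> V \<rightarrow> W\<close> induced by \<open>\<beta>\<close>, applied to \<open>\<Delta> y\<close>.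
\<close>

definition sweedler ::
  "('k::field \<Rightarrow> 'w::ab_group_add \<Rightarrow> 'w) \<Rightarrow> ('v \<Rightarrow> ('v list \<Rightarrow>\<^sub>0 'k) set)
     \<Rightarrow> ('v \<Rightarrow> 'v \<Rightarrow> 'w) \<Rightarrow> 'v \<Rightarrow> 'w" where
  "sweedler t \<Delta> \<beta> y = tensor_lift t (\<lambda>ys. \<beta> (ys ! 0) (ys ! 1)) (\<Delta> y)"

lemma sweedler_sum:
  assumes t: "vector_space t" and b: "multilinear s t 2 (\<lambda>ys. \<beta> (ys ! 0) (ys ! 1))"
    and y: "\<Delta> y = tensor s [a1, a2] + tensor s [b1, b2]"
  shows "sweedler t \<Delta> \<beta> y = \<beta> a1 a2 + \<beta> b1 b2"
proof -
  have p: "tensor s [u, v] \<in> tensor_power s 2" for u v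
    using tensor_in_tensor_power[of s "[u, v]"] by (simp add: numeral_2_eq_2)
  have l: "tensor_lift t (\<lambda>ys. \<beta> (ys ! 0) (ys ! 1)) (tensor s [u, v]) = \<beta> u v" for u v
    using tensor_lift_tensor[OF t, of s "[u, v]" "\<lambda>ys. \<beta> (ys ! 0) (ys ! 1)"] b
    by (simp add: numeral_2_eq_2)
  show ?thesis unfolding sweedler_def y tensor_lift_add[OF t b p p] l ..
qed

definition reversibility_condition ::
  "('k::field \<Rightarrow> 'v::ab_group_add \<Rightarrow> 'v) \<Rightarrow> ('v \<Rightarrow> ('v list \<Rightarrow>\<^sub>0 'k) set) \<Rightarrow> ('v \<Rightarrow> 'k)
     \<Rightarrow> (('v list \<Rightarrow>\<^sub>0 'k) set \<Rightarrow> 'v) \<Rightarrow> (('v list \<Rightarrow>\<^sub>0 'k) set \<Rightarrow> 'v) \<Rightarrow> bool" where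
  "reversibility_condition s \<Delta> \<epsilon> T T' \<longleftrightarrow>
     (\<forall>x y z.
        sweedler s \<Delta> (\<lambda>y1 y2. sweedler s \<Delta> (\<lambda>z1 z2.
          T' (tensor s [T (tensor s [x, y2, z2]), z1, y1])) z) y = s (\<epsilon> y * \<epsilon> z) x) \<and>
     (\<forall>x y z.
        sweedler s \<Delta> (\<lambda>y1 y2. sweedler s \<Delta> (\<lambda>z1 z2.
          T (tensor s [T' (tensor s [x, y2, z2]), z1, y1])) z) y = s (\<epsilon> y * \<epsilon> z) x)"


section \<open>The structure on \<open>X = k \<oplus> L\<close>\<close>

locale lie_algebra = vector_space smul
  for smul :: "'k::field \<Rightarrow> 'l::ab_group_add \<Rightarrow> 'l" +
  fixes bracket :: "'l \<Rightarrow> 'l \<Rightarrow> 'l"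
  assumes bracket_linear_left: "Vector_Spaces.linear smul smul (\<lambda>x. bracket x y)"
    and bracket_linear_right: "Vector_Spaces.linear smul smul (bracket x)"
    and bracket_self: "bracket x x = 0"
    and jacobi: "bracket x (bracket y z) + bracket y (bracket z x) + bracket z (bracket x y) = 0"

abbreviation X_scale ::
  "('k::field \<Rightarrow> 'l::ab_group_add \<Rightarrow> 'l) \<Rightarrow> 'k \<Rightarrow> 'k \<times> 'l \<Rightarrow> 'k \<times> 'l" where
  "X_scale smul \<equiv> module_prod.scale (*) smul"

definition X_Delta ::
  "('k::field \<Rightarrow> 'l::ab_group_add \<Rightarrow> 'l) \<Rightarrow> 'k \<times> 'l \<Rightarrow> (('k \<times> 'l) list \<Rightarrow>\<^sub>0 'k) set" where
  "X_Delta smul = (\<lambda>(a, x).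
     tensor (X_scale smul) [(a, x), (1, 0)] + tensor (X_scale smul) [(1, 0), (0, x)])"

definition X_eps :: "'k::field \<times> 'l::ab_group_add \<Rightarrow> 'k" where
  "X_eps = (\<lambda>(a, x). a)"

definition X_T ::
  "('k::field \<Rightarrow> 'l::ab_group_add \<Rightarrow> 'l) \<Rightarrow> ('l \<Rightarrow> 'l \<Rightarrow> 'l)
     \<Rightarrow> (('k \<times> 'l) list \<Rightarrow>\<^sub>0 'k) set \<Rightarrow> 'k \<times> 'l" where
  "X_T smul bracket = tensor_lift (X_scale smul)
     (\<lambda>us. case us of [(a, x), (b, y), (c, z)] \<Rightarrow>
        (a * b * c,
         smul (b * c) x + smul c (bracket x y) + smul b (bracket x z)
           + bracket (bracket x y) z))"

definition X_T_tilde ::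
  "('k::field \<Rightarrow> 'l::ab_group_add \<Rightarrow> 'l) \<Rightarrow> ('l \<Rightarrow> 'l \<Rightarrow> 'l)
     \<Rightarrow> (('k \<times> 'l) list \<Rightarrow>\<^sub>0 'k) set \<Rightarrow> 'k \<times> 'l" where
  "X_T_tilde smul bracket = tensor_lift (X_scale smul)
     (\<lambda>us. case us of [(a, x), (b, y), (c, z)] \<Rightarrow>
        (a * b * c,
         smul (b * c) x - smul c (bracket x y) - smul b (bracket x z)
           + bracket (bracket x y) z))"

context lie_algebra
begin

lemma X_scale_Pair [simp]: "X_scale smul c (a, x) = (c * a, smul c x)"
  and vector_space_X: "vector_space (X_scale smul)"
proof -
  interpret k: vector_space "(*) :: 'k \<Rightarrow> 'k \<Rightarrow> 'k" by unfold_locales (auto simp: algebra_simps)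
  interpret vector_space_prod "(*) :: 'k \<Rightarrow> 'k \<Rightarrow> 'k" smul by unfold_locales
  show "X_scale smul c (a, x) = (c * a, smul c x)" by (rule scale_prod)
  show "vector_space (X_scale smul)" by (rule p.vector_space_axioms)
qed

lemma bracket_simps:
  "bracket (x + y) z = bracket x z + bracket y z"
  "bracket z (x + y) = bracket z x + bracket z y"
  "bracket (smul c x) z = smul c (bracket x z)"
  "bracket z (smul c x) = smul c (bracket z x)"
proof -
  interpret l: Vector_Spaces.linear smul smul "\<lambda>x. bracket x z" by (rule bracket_linear_left)
  interpret r: Vector_Spaces.linear smul smul "bracket z" by (rule bracket_linear_right)
  show "bracket (x + y) z = bracket x z + bracket y z" by (rule l.add)
  show "bracket z (x + y) = bracket z x + bracket z y" by (rule r.add)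
  show "bracket (smul c x) z = smul c (bracket x z)" by (rule l.scale)
  show "bracket z (smul c x) = smul c (bracket z x)" by (rule r.scale)
qed

lemma multilinear_X_T:
  "multilinear (X_scale smul) (X_scale smul) 3
     (\<lambda>us. case us of [(a, x), (b, y), (c, z)] \<Rightarrow>
        (a * b * c,
         smul (b * c) x + smul c (bracket x y) + smul b (bracket x z)
           + bracket (bracket x y) z))"
  unfolding multilinear_def
  by (auto simp: length_Suc_conv eval_nat_numeral less_Suc_eq bracket_simps algebra_simps)

lemma multilinear_X_T_tilde:
  "multilinear (X_scale smul) (X_scale smul) 3
     (\<lambda>us. case us of [(a, x), (b, y), (c, z)] \<Rightarrow>
        (a * b * c,
         smul (b * c) x - smul c (bracket x y) - smul b (bracket x z)
           + bracket (bracket x y) z))"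
  unfolding multilinear_def
  by (auto simp: length_Suc_conv eval_nat_numeral less_Suc_eq bracket_simps algebra_simps)

lemma X_T_tensor:
  "X_T smul bracket (tensor (X_scale smul) [(a, x), (b, y), (c, z)]) =
     (a * b * c,
      smul (b * c) x + smul c (bracket x y) + smul b (bracket x z) + bracket (bracket x y) z)"
  unfolding X_T_def
  by (subst tensor_lift_tensor[OF vector_space_X]) (use multilinear_X_T in \<open>simp_all add: eval_nat_numeral\<close>)

lemma X_T_tilde_tensor:
  "X_T_tilde smul bracket (tensor (X_scale smul) [(a, x), (b, y), (c, z)]) =
     (a * b * c,
      smul (b * c) x - smul c (bracket x y) - smul b (bracket x z) + bracket (bracket x y) z)"
  unfolding X_T_tilde_def
  by (subst tensor_lift_tensor[OF vector_space_X]) (use multilinear_X_T_tilde in \<open>simp_all add: eval_nat_numeral\<close>)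

lemma X_Delta_linear:
  "X_Delta smul (u + v) = X_Delta smul u + X_Delta smul v"
  "X_Delta smul (X_scale smul c u) = tensor_scale (X_scale smul) 2 c (X_Delta smul u)"
proof -
  let ?s = "X_scale smul"
  obtain a x b y where uv: "u = (a, x)" "v = (b, y)" by fastforce
  have p: "tensor ?s [p, q] \<in> tensor_power ?s 2" for p q
    using tensor_in_tensor_power[of ?s "[p, q]"] by (simp add: numeral_2_eq_2)
  show "X_Delta smul (u + v) = X_Delta smul u + X_Delta smul v"
    using tensor_add[of 0 "[0, (1, 0)]" ?s u v] tensor_add[of 1 "[(1, 0), 0]" ?s "(0, x)" "(0, y)"]
    by (simp add: X_Delta_def uv ac_simps)
  show "X_Delta smul (?s c u) = tensor_scale ?s 2 c (X_Delta smul u)"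
    using tensor_smult[of 0 "[0, (1, 0)]" ?s c u] tensor_smult[of 1 "[(1, 0), 0]" ?s c "(0, x)"]
    by (simp add: X_Delta_def uv tensor_scale_add[OF p p] flip: numeral_2_eq_2)
qed

end

end

theory Submission
  imports Defs
begin

text \<open>
  Every \<open>v = (b, y)\<close> acts on \<open>X\<close> by \<open>R\<^sub>e v (a, x) = (ab, bx + e[x, y])\<close>, and \<open>T\<close>, \<open>T~\<close> are the
  twofold iterates \<open>u \<otimes> v \<otimes> w \<mapsto> R\<^sub>e w (R\<^sub>e v u)\<close> for \<open>e = 1\<close> and \<open>e = -1\<close>. Since \<open>(1, 0)\<close> acts as the
  identity and the brackets of opposite sign cancel, \<open>R\<^sub>-\<^sub>e v\<^sup>(\<^sup>1\<^sup>) (R\<^sub>e v\<^sup>(\<^sup>2\<^sup>) u) = \<epsilon>(v) u\<close>. The reversibility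
  condition is this cancellation, used first for \<open>z\<close> and then for \<open>y\<close>.
\<close>

context lie_algebra
begin

definition X_act :: "'k \<Rightarrow> 'k \<times> 'l \<Rightarrow> 'k \<times> 'l \<Rightarrow> 'k \<times> 'l" where
  "X_act e v u = (fst u * fst v, smul (fst v) (snd u) + smul e (bracket (snd u) (snd v)))"

lemma bracket_zero_right: "bracket x 0 = 0"
  using bracket_simps(2)[of x 0 0] by simp

lemma X_act_simps:
  "X_act e v (u + u') = X_act e v u + X_act e v u'"
  "X_act e (v + v') u = X_act e v u + X_act e v' u"
  "X_act e v (X_scale smul c u) = X_scale smul c (X_act e v u)"
  "X_act e (X_scale smul c v) u = X_scale smul c (X_act e v u)"
  by (cases u; cases v; cases u'; cases v'; simp add: X_act_def bracket_simps algebra_simps)+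

lemma X_act_unit: "X_act e (1, 0) u = u"
  by (simp add: X_act_def bracket_zero_right)

lemma linear_X_act: "Vector_Spaces.linear (X_scale smul) (X_scale smul) (X_act e v)"
proof -
  interpret X: vector_space "X_scale smul" by (rule vector_space_X)
  show ?thesis by unfold_locales (simp_all add: X_act_simps)
qed

lemma X_T_eq_X_act:
  "X_T smul bracket (tensor (X_scale smul) [u, v, w]) = X_act 1 w (X_act 1 v u)"
  by (cases u; cases v; cases w)
     (simp add: X_T_tensor X_act_def bracket_simps algebra_simps)

lemma X_T_tilde_eq_X_act:
  "X_T_tilde smul bracket (tensor (X_scale smul) [u, v, w]) = X_act (- 1) w (X_act (- 1) v u)"
proof -
  have diff: "bracket (x - y) z = bracket x z - bracket y z" for x y z
    using bracket_simps(1)[of "x - y" y z] by simp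
  show ?thesis
    by (cases u; cases v; cases w)
       (simp add: X_T_tilde_tensor X_act_def bracket_simps diff algebra_simps)
qed

text \<open>The linear \<open>f\<close> is whatever remains to be applied outside. By
  \<open>X_act_unit\<close> each summand of the coproduct leaves one action, and their brackets have
  opposite signs.\<close>

lemma sweedler_X_act_cancel:
  assumes "Vector_Spaces.linear (X_scale smul) (X_scale smul) f"
  shows "sweedler (X_scale smul) (X_Delta smul)
           (\<lambda>v1 v2. f (X_act (- e) v1 (X_act e v2 u))) v = f (X_scale smul (X_eps v) u)"
proof -
  interpret f: Vector_Spaces.linear "X_scale smul" "X_scale smul" f by fact
  obtain b y where v: "v = (b, y)" by fastforce
  have "multilinear (X_scale smul) (X_scale smul) 2
          (\<lambda>vs. f (X_act (- e) (vs ! 0) (X_act e (vs ! 1) u)))"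
    unfolding multilinear_def
    by (auto simp: eval_nat_numeral less_Suc_eq X_act_simps f.add f.scale simp del: split_paired_All)
  then have "sweedler (X_scale smul) (X_Delta smul)
               (\<lambda>v1 v2. f (X_act (- e) v1 (X_act e v2 u))) v =
             f (X_act (- e) (b, y) u) + f (X_act e (0, y) u)"
    by (subst sweedler_sum[OF vector_space_X]) (auto simp: X_Delta_def v X_act_unit)
  also have "\<dots> = f (X_scale smul (X_eps v) u)"
    unfolding f.add[symmetric]
    by (cases u) (simp add: X_act_def X_eps_def v mult.commute)
  finally show ?thesis .
qed

lemma sweedler_X_act_reversible:
  "sweedler (X_scale smul) (X_Delta smul) (\<lambda>y1 y2. sweedler (X_scale smul) (X_Delta smul)
     (\<lambda>z1 z2. X_act (- e) y1 (X_act (- e) z1 (X_act e z2 (X_act e y2 x)))) z) y =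
   X_scale smul (X_eps y * X_eps z) x"
proof -
  interpret X: vector_space "X_scale smul" by (rule vector_space_X)
  \<comment> \<open>Cancelling at \<open>z\<close> leaves the factor \<open>X_eps z\<close>; pulled
    outside, it is the \<open>f\<close> for the cancellation at \<open>y\<close>.\<close>
  have "Vector_Spaces.linear (X_scale smul) (X_scale smul) (X_scale smul (X_eps z))"
    by unfold_locales (simp_all add: X.scale_right_distrib mult.commute)
  then show ?thesis
    by (simp add: sweedler_X_act_cancel linear_X_act X_act_simps mult.commute)
qed

end

theorem proposition3p7:
  fixes smul :: "'k::field \<Rightarrow> 'l::ab_group_add \<Rightarrow> 'l"
    and bracket :: "'l \<Rightarrow> 'l \<Rightarrow> 'l"
  assumes "lie_algebra smul bracket"
  shows "reversibility_condition (X_scale smul) (X_Delta smul) X_eps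
           (X_T smul bracket) (X_T_tilde smul bracket)"
proof -
  interpret lie_algebra smul bracket by fact
  show ?thesis
    unfolding reversibility_condition_def X_T_eq_X_act X_T_tilde_eq_X_act
    \<comment> \<open>Here \<open>e = 1\<close> is \<open>X_T\<close> followed by
      \<open>X_T_tilde\<close>, and \<open>e = -1\<close> the reverse order.\<close>
    using sweedler_X_act_reversible[of 1] sweedler_X_act_reversible[of "- 1"] by simp
qed

end
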